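(* There is an absolute constant $c>0$ such that the following holds. Let $\mathcal{A}$ be a local $(1,\tfrac14)$-Lipschitz filter over the hypercube $\{0,1\}^d$ for functions with range $[0,r]$. Then for all even integers $r\ge4$ and all integers $d\ge 2^{16}r$, there exists a function $f:\{0,1\}^d\to[0,r]$ such that the worst-case (over queries and random seeds) number of lookups that $\mathcal{A}$ makes on input $f$ is at least $(d/r)^{c r}$.
   Context: The hypercube $\{0,1\}^d$ is the graph where two points are adjacent iff they differ in exactly one coordinate; its distance is the Hamming distance $|x-y|$. A function $g$ is Lipschitz if $|g(x)-g(y)|\le|x-y|$ for all $x,y$. A local $(1,\tfrac14)$-Lipschitz filter is a randomized algorithm $\mathcal{A}(x,\rho)$ that gets lookup (oracle) access to $f:\{0,1\}^d\to[0,r]$, a query $x\in\{0,1\}^d$ and a random seed $\rho$, such that with probability at least $3/4$ over $\rho$, the map $x\mapsto\mathcal{A}(x,\rho)$ is a Lipschitz function $g_\rho$, and moreover $g_\rho=f$ whenever $f$ is Lipschitz. A lookup is an oracle call to $f$. *)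

theory Defs
  imports "HOL-Probability.Probability"
begin

definition cube :: "nat \<Rightarrow> bool list set" where
  "cube d = {x. length x = d}"

definition hdist :: "bool list \<Rightarrow> bool list \<Rightarrow> nat" where
  "hdist x y = card {i. i < length x \<and> x ! i \<noteq> y ! i}"

definition lipschitz_cube :: "nat \<Rightarrow> (bool list \<Rightarrow> real) \<Rightarrow> bool" where
  "lipschitz_cube d g \<longleftrightarrow>
     (\<forall>x\<in>cube d. \<forall>y\<in>cube d. \<bar>g x - g y\<bar> \<le> real (hdist x y))"

text \<open>A function {0,1}^d -> [0,r], represented extensionally (value 0 off the cube).\<close>
definition range_fun :: "nat \<Rightarrow> real \<Rightarrow> (bool list \<Rightarrow> real) \<Rightarrow> bool" where
  "range_fun d r f \<longleftrightarrow> (\<forall>x\<in>cube d. 0 \<le> f x \<and> f x \<le> r) \<and> (\<forall>x. x \<notin> cube d \<longrightarrow> f x = 0)"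

text \<open>Adaptive oracle computations: either return a value, or look up f at a point
  and continue depending on the answer.\<close>
datatype 'r ocomp = Ret 'r | Look "bool list" "real \<Rightarrow> 'r ocomp"

primrec run_out :: "(bool list \<Rightarrow> real) \<Rightarrow> 'r ocomp \<Rightarrow> 'r" where
  "run_out f (Ret v) = v"
| "run_out f (Look q k) = run_out f (k (f q))"

primrec lookups :: "(bool list \<Rightarrow> real) \<Rightarrow> 'r ocomp \<Rightarrow> nat" where
  "lookups f (Ret v) = 0"
| "lookups f (Look q k) = Suc (lookups f (k (f q)))"

definition lipschitz_filter ::
  "nat \<Rightarrow> real \<Rightarrow> (bool list \<Rightarrow> nat \<Rightarrow> real ocomp) \<Rightarrow> nat pmf \<Rightarrow> bool" where
  "lipschitz_filter d r A P \<longleftrightarrow>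
     (\<forall>f. range_fun d r f \<longrightarrow>
        measure_pmf.prob P
          {\<rho>. lipschitz_cube d (\<lambda>x. run_out f (A x \<rho>)) \<and>
               (lipschitz_cube d f \<longrightarrow> (\<forall>x\<in>cube d. run_out f (A x \<rho>) = f x))}
        \<ge> 3/4)"

end

theory Submission
  imports Defs
begin

text \<open>
  Write \<open>r = 2 * k\<close>. The valley at \<open>x\<close> is the function equal to \<open>k\<close> except for a cone of radius \<open>k\<close>
  descending to \<open>0\<close> at \<open>x\<close>; the hill at \<open>y\<close> has a cone ascending to \<open>2 * k\<close> at \<open>y\<close>. Both are
  Lipschitz, so a filter must preserve them. If \<open>x\<close> and \<open>y\<close> are at distance \<open>2 * k - 1\<close>, the two
  cones are disjoint and can be combined into one function, which no Lipschitz function can match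
  at both \<open>x\<close> and \<open>y\<close>. Hence for every such pair, with probability at least \<open>1/4\<close> over the seed,
  either the run at \<open>x\<close> on the valley looks up a point near \<open>y\<close>, or the run at \<open>y\<close> on the hill
  looks up a point near \<open>x\<close>. Averaging over all pairs shows that this needs many lookups, because
  a point lies near only a tiny fraction of the sphere of radius \<open>2 * k - 1\<close>.
\<close>

section \<open>Geometry of the hypercube\<close>

definition diff_set :: "bool list \<Rightarrow> bool list \<Rightarrow> nat set" where
  "diff_set x y = {i. i < length x \<and> x ! i \<noteq> y ! i}"

lemma hdist_eq_card_diff_set: "hdist x y = card (diff_set x y)"
  by (simp add: hdist_def diff_set_def)

lemma finite_diff_set [simp]: "finite (diff_set x y)"
  by (simp add: diff_set_def)

lemma diff_set_subset: "x \<in> cube d \<Longrightarrow> diff_set x y \<subseteq> {..<d}"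
  by (auto simp: diff_set_def cube_def)

lemma finite_cube [simp]: "finite (cube d)"
  using finite_lists_length_eq[of "UNIV :: bool set" d] by (simp add: cube_def)

lemma card_cube: "card (cube d) = 2 ^ d"
  using card_lists_length_eq[of "UNIV :: bool set" d] by (simp add: cube_def card_UNIV_bool)

lemma hdist_self [simp]: "hdist x x = 0"
  by (simp add: hdist_def)

lemma hdist_commute:
  assumes "x \<in> cube d" "y \<in> cube d"
  shows "hdist x y = hdist y x"
  using assms unfolding hdist_def cube_def by (auto intro: arg_cong[where f = card])

lemma hdist_triangle:
  assumes "x \<in> cube d" "y \<in> cube d" "z \<in> cube d"
  shows "hdist x z \<le> hdist x y + hdist y z"
proof -
  have "diff_set x z \<subseteq> diff_set x y \<union> diff_set y z"
    using assms by (auto simp: diff_set_def cube_def)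
  then have "hdist x z \<le> card (diff_set x y \<union> diff_set y z)"
    unfolding hdist_eq_card_diff_set by (intro card_mono) auto
  also have "\<dots> \<le> hdist x y + hdist y z"
    unfolding hdist_eq_card_diff_set by (rule card_Un_le)
  finally show ?thesis .
qed

text \<open>The inverse flips the coordinates in a given set. Distance from \<open>x\<close> becomes
  cardinality, so counting points on spheres turns into counting subsets.\<close>

lemma bij_betw_diff_set:
  assumes x: "x \<in> cube d"
  shows "bij_betw (diff_set x) (cube d) (Pow {..<d})"
proof (rule bij_betwI[where g = "\<lambda>S. map (\<lambda>i. (x ! i) \<noteq> (i \<in> S)) [0..<d]"])
  show "diff_set x \<in> cube d \<rightarrow> Pow {..<d}"
    using diff_set_subset[OF x] by blast
  show "(\<lambda>S. map (\<lambda>i. (x ! i) \<noteq> (i \<in> S)) [0..<d]) \<in> Pow {..<d} \<rightarrow> cube d"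
    by (auto simp: cube_def)
  show "map (\<lambda>i. (x ! i) \<noteq> (i \<in> diff_set x y)) [0..<d] = y" if "y \<in> cube d" for y
    using that x by (intro nth_equalityI) (auto simp: cube_def diff_set_def)
  show "diff_set x (map (\<lambda>i. (x ! i) \<noteq> (i \<in> S)) [0..<d]) = S" if "S \<in> Pow {..<d}" for S
    using that x by (auto simp: cube_def diff_set_def)
qed

section \<open>Spheres, and how few of their points lie near a given point\<close>

definition hsphere :: "nat \<Rightarrow> bool list \<Rightarrow> nat \<Rightarrow> bool list set" where
  "hsphere d x n = {y \<in> cube d. hdist x y = n}"

lemma finite_hsphere [simp]: "finite (hsphere d x n)"
  by (simp add: hsphere_def)

lemma card_hsphere:
  assumes x: "x \<in> cube d"
  shows "card (hsphere d x n) = d choose n"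
proof -
  have "bij_betw (diff_set x) (hsphere d x n) {S. S \<subseteq> {..<d} \<and> card S = n}"
  proof -
    have *: "diff_set x ` hsphere d x n = {S \<in> diff_set x ` cube d. card S = n}"
      by (auto simp: hsphere_def hdist_eq_card_diff_set)
    have "diff_set x ` hsphere d x n = {S. S \<subseteq> {..<d} \<and> card S = n}"
      unfolding * bij_betw_imp_surj_on[OF bij_betw_diff_set[OF x]] by auto
    moreover have "inj_on (diff_set x) (hsphere d x n)"
      using bij_betw_imp_inj_on[OF bij_betw_diff_set[OF x]]
      by (rule inj_on_subset) (auto simp: hsphere_def)
    ultimately show ?thesis by (simp add: bij_betw_def)
  qed
  then show ?thesis
    by (simp add: bij_betw_same_card n_subsets)
qed

text \<open>Each such \<open>S\<close> splits into an \<open>a\<close>-element subset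
  \<open>U\<close> of \<open>T\<close> and \<open>b\<close> further elements outside
  \<open>U\<close>. A set may arise from several choices of \<open>U\<close>, hence only an upper
  bound.\<close>

lemma card_subsets_large_intersection:
  assumes "finite A" "T \<subseteq> A"
  shows "card {S. S \<subseteq> A \<and> card S = a + b \<and> a \<le> card (S \<inter> T)}
           \<le> (card T choose a) * ((card A - a) choose b)"
proof -
  have finT: "finite T" using assms finite_subset by blast
  define UU where "UU = {U. U \<subseteq> T \<and> card U = a}"
  define VV where "VV U = {V. V \<subseteq> A - U \<and> card V = b}" for U
  have finUU: "finite UU" and finVV: "finite (VV U)" for U
    using finT assms by (simp_all add: UU_def VV_def)
  have "{S. S \<subseteq> A \<and> card S = a + b \<and> a \<le> card (S \<inter> T)} \<subseteq> (\<lambda>(U, V). U \<union> V) ` Sigma UU VV"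
  proof
    fix S assume "S \<in> {S. S \<subseteq> A \<and> card S = a + b \<and> a \<le> card (S \<inter> T)}"
    then have S: "S \<subseteq> A" "card S = a + b" "a \<le> card (S \<inter> T)" by auto
    have finS: "finite S" using S assms finite_subset by blast
    obtain U where U: "U \<subseteq> S \<inter> T" "card U = a"
      using S(3) by (meson obtain_subset_with_card_n)
    have "finite U" using U(1) finS by (meson finite_Int finite_subset)
    then have "card (S - U) = b"
      using U S(2) by (subst card_Diff_subset) auto
    then have "(U, S - U) \<in> Sigma UU VV"
      using U S by (auto simp: UU_def VV_def)
    moreover have "S = U \<union> (S - U)" using U by auto
    ultimately show "S \<in> (\<lambda>(U, V). U \<union> V) ` Sigma UU VV"
      by (intro image_eqI[where x = "(U, S - U)"]) simp_all
  qed
  then have "card {S. S \<subseteq> A \<and> card S = a + b \<and> a \<le> card (S \<inter> T)}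
               \<le> card ((\<lambda>(U, V). U \<union> V) ` Sigma UU VV)"
    using finUU finVV by (intro card_mono) auto
  also have "\<dots> \<le> card (Sigma UU VV)"
    using finUU finVV by (intro card_image_le) auto
  also have "\<dots> = (\<Sum>U\<in>UU. card (VV U))"
    using finUU finVV by (intro card_SigmaI) auto
  also have "\<dots> = (\<Sum>U\<in>UU. (card A - a) choose b)"
  proof (rule sum.cong)
    fix U assume U: "U \<in> UU"
    then have "finite U" "U \<subseteq> A" "card U = a"
      using finT assms by (auto simp: UU_def dest: finite_subset)
    then have "card (A - U) = card A - a"
      by (simp add: card_Diff_subset)
    then show "card (VV U) = (card A - a) choose b"
      using assms(1) by (simp add: VV_def n_subsets)
  qed simp
  also have "\<dots> = (card T choose a) * ((card A - a) choose b)"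
    using finT by (simp add: UU_def n_subsets)
  finally show ?thesis .
qed

text \<open>\<open>diff_set z y\<close> is the symmetric difference of \<open>diff_set x y\<close>
  and \<open>diff_set x z\<close>.\<close>

lemma hdist_via:
  assumes "x \<in> cube d" "y \<in> cube d" "z \<in> cube d"
  shows "hdist x z + hdist x y = hdist z y + 2 * card (diff_set x y \<inter> diff_set x z)"
proof -
  let ?S = "diff_set x y" and ?T = "diff_set x z"
  have "diff_set z y = (?S - ?T) \<union> (?T - ?S)"
    using assms by (auto simp: diff_set_def cube_def)
  then have "hdist z y = card (?S - ?T) + card (?T - ?S)"
    unfolding hdist_eq_card_diff_set by (simp add: card_Un_disjoint disjoint_iff)
  moreover have "card ?S = card (?S - ?T) + card (?S \<inter> ?T)"
    using card_Int_Diff[of ?S ?T] by simp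
  moreover have "card ?T = card (?T - ?S) + card (?S \<inter> ?T)"
    using card_Int_Diff[of ?T ?S] by (simp add: Int_commute)
  ultimately show ?thesis
    by (simp add: hdist_eq_card_diff_set)
qed

text \<open>Bounds how many \<open>y\<close> a single lookup at \<open>z\<close> can serve. Being
  close to \<open>z\<close> forces the flips leading to \<open>y\<close> to share at least
  \<open>k\<close> elements with those leading to \<open>z\<close>. The factor
  \<open>2 ^ (3*k)\<close> bounds the choices of \<open>k\<close> shared flips; if \<open>z\<close>
  is farther than \<open>3 * k\<close> from \<open>x\<close>, the triangle inequality leaves no
  \<open>y\<close> at all.\<close>

lemma card_hsphere_near_point:
  assumes x: "x \<in> cube d" and z: "z \<in> cube d" and k: "k \<ge> 1"
  shows "card {y \<in> hsphere d x (2*k-1). hdist z y < k} \<le> 2 ^ (3*k) * ((d - k) choose (k - 1))"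
proof (cases "hdist x z \<le> 3 * k")
  case True
  let ?Y = "{y \<in> hsphere d x (2*k-1). hdist z y < k}"
  let ?T = "diff_set x z"
  let ?SS = "{S. S \<subseteq> {..<d} \<and> card S = k + (k - 1) \<and> k \<le> card (S \<inter> ?T)}"
  have "diff_set x ` ?Y \<subseteq> ?SS"
  proof
    fix S assume "S \<in> diff_set x ` ?Y"
    then obtain y where y: "y \<in> cube d" "hdist x y = 2*k-1" "hdist z y < k" "S = diff_set x y"
      by (auto simp: hsphere_def)
    have "2 * k - 1 \<le> hdist x z + hdist z y"
      using hdist_triangle[OF x z y(1)] y(2) by simp
    moreover have "hdist x z + (2*k-1) = hdist z y + 2 * card (S \<inter> ?T)"
      using hdist_via[OF x y(1) z] y by simp
    \<comment> \<open>As \<open>hdist z y\<close> is at most \<open>k - 1\<close>, the first fact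
      gives \<open>hdist x z\<close> at least \<open>k\<close>; the second then makes twice the
      intersection at least \<open>k + (2*k - 1) - (k - 1) = 2*k\<close>.\<close>
    ultimately have "k \<le> card (S \<inter> ?T)" using y(3) k by linarith
    then show "S \<in> ?SS"
      using y k diff_set_subset[OF x] by (auto simp: hdist_eq_card_diff_set)
  qed
  moreover have "inj_on (diff_set x) ?Y"
    using bij_betw_imp_inj_on[OF bij_betw_diff_set[OF x]]
    by (rule inj_on_subset) (auto simp: hsphere_def)
  ultimately have "card ?Y \<le> card ?SS"
    by (intro card_inj_on_le[of "diff_set x"]) auto
  also have "\<dots> \<le> (card ?T choose k) * ((d - k) choose (k - 1))"
    using card_subsets_large_intersection[of "{..<d}" ?T k "k - 1"] diff_set_subset[OF x] by simp
  also have "(card ?T choose k) \<le> 2 ^ card ?T"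
    by (rule binomial_le_pow2)
  also have "(2::nat) ^ card ?T \<le> 2 ^ (3*k)"
    using True by (intro power_increasing) (auto simp: hdist_eq_card_diff_set)
  finally show ?thesis by simp
next
  case False
  have "\<not> hdist z y < k" if "y \<in> hsphere d x (2*k-1)" for y
  proof -
    have y: "y \<in> cube d" "hdist x y = 2*k-1" using that by (auto simp: hsphere_def)
    have "hdist x z \<le> hdist x y + hdist z y"
      using hdist_triangle[OF x y(1) z] hdist_commute[OF y(1) z] by simp
    then show ?thesis using False y(2) by linarith
  qed
  then have "{y \<in> hsphere d x (2*k-1). hdist z y < k} = {}" by blast
  then show ?thesis by (simp only: card.empty)
qed

section \<open>Oracle computations\<close>

primrec queried :: "(bool list \<Rightarrow> real) \<Rightarrow> 'r ocomp \<Rightarrow> bool list set" where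
  "queried f (Ret v) = {}"
| "queried f (Look q k) = insert q (queried f (k (f q)))"

lemma finite_queried [simp]: "finite (queried f c)"
  by (induction c) auto

lemma card_queried_le: "card (queried f c) \<le> lookups f c"
  by (induction c) (auto simp: card_insert_if le_SucI)

text \<open>Equal answers lead to the same next lookup, so the two runs never diverge. This is why a
  filter cannot tell a valley or a hill from the combined function without a lookup where they
  differ.\<close>

lemma run_out_cong_queried:
  "(\<And>z. z \<in> queried f c \<Longrightarrow> f z = g z) \<Longrightarrow> run_out f c = run_out g c"
proof (induction c)
  case (Look q k)
  have "g q = f q" using Look.prems[of q] by simp
  moreover have "run_out f (k (f q)) = run_out g (k (f q))"
    using Look.prems by (intro Look.IH) auto
  ultimately show ?case by simp
qed simp

section \<open>Valleys, hills and their combination\<close>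

definition valley :: "nat \<Rightarrow> nat \<Rightarrow> bool list \<Rightarrow> bool list \<Rightarrow> real" where
  "valley d k x z = (if z \<in> cube d then min (real k) (real (hdist x z)) else 0)"

definition hill :: "nat \<Rightarrow> nat \<Rightarrow> bool list \<Rightarrow> bool list \<Rightarrow> real" where
  "hill d k y z = (if z \<in> cube d then max (real k) (2 * real k - real (hdist y z)) else 0)"

definition valley_hill :: "nat \<Rightarrow> nat \<Rightarrow> bool list \<Rightarrow> bool list \<Rightarrow> bool list \<Rightarrow> real" where
  "valley_hill d k x y z = (if hdist z y < k then hill d k y z else valley d k x z)"

lemma range_fun_valley: "range_fun d (2 * real k) (valley d k x)"
  by (auto simp: range_fun_def valley_def)

lemma range_fun_hill: "range_fun d (2 * real k) (hill d k y)"
  by (auto simp: range_fun_def hill_def)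

lemma range_fun_valley_hill: "range_fun d (2 * real k) (valley_hill d k x y)"
  using range_fun_valley[of d k x] range_fun_hill[of d k y]
  by (auto simp: range_fun_def valley_hill_def)

lemma hdist_diff_le:
  assumes "x \<in> cube d" "u \<in> cube d" "v \<in> cube d"
  shows "\<bar>real (hdist x u) - real (hdist x v)\<bar> \<le> real (hdist u v)"
  using hdist_triangle[OF assms] hdist_triangle[OF assms(1,3,2)] hdist_commute[OF assms(2,3)]
  by linarith

lemma lipschitz_cube_valley:
  assumes "x \<in> cube d"
  shows "lipschitz_cube d (valley d k x)"
  unfolding lipschitz_cube_def
proof (intro ballI)
  fix u v assume "u \<in> cube d" "v \<in> cube d"
  then show "\<bar>valley d k x u - valley d k x v\<bar> \<le> real (hdist u v)"
    using hdist_diff_le[OF assms, of u v] by (auto simp: valley_def min_def)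
qed

lemma lipschitz_cube_hill:
  assumes "x \<in> cube d"
  shows "lipschitz_cube d (hill d k x)"
  unfolding lipschitz_cube_def
proof (intro ballI)
  fix u v assume "u \<in> cube d" "v \<in> cube d"
  then show "\<bar>hill d k x u - hill d k x v\<bar> \<le> real (hdist u v)"
    using hdist_diff_le[OF assms, of u v] by (auto simp: hill_def max_def)
qed

text \<open>Lookups may leave the cube, where both branches are 0; so only cube points near
  \<open>y\<close> can reveal the difference.\<close>

lemma valley_hill_eq_valley:
  assumes "z \<in> cube d \<Longrightarrow> \<not> hdist z y < k"
  shows "valley_hill d k x y z = valley d k x z"
  using assms by (auto simp: valley_hill_def valley_def hill_def)

text \<open>Away from both centres the valley and the hill share the plateau value \<open>k\<close>,
  so there the choice of branch is immaterial.\<close>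

lemma valley_hill_eq_hill:
  assumes "x \<in> cube d" "y \<in> cube d"
    and "z \<in> cube d \<Longrightarrow> \<not> hdist z x < k"
  shows "valley_hill d k x y z = hill d k y z"
proof (cases "z \<in> cube d")
  case True
  then show ?thesis
    using assms hdist_commute[of x d z] hdist_commute[of y d z]
    by (auto simp: valley_hill_def valley_def hill_def)
qed (simp add: valley_hill_def valley_def hill_def)

section \<open>The averaging argument\<close>

text \<open>For a fixed seed, a union bound over the looked-up points limits the number of
  \<open>y\<close> near one of them; linearity of expectation then gives the sum of probabilities.
  \<open>Q\<close> is abstract so that both valley and hill runs fit.\<close>

lemma sum_prob_queried_near_le:
  assumes x: "x \<in> cube d" and k: "k \<ge> 1"
    and Q: "\<And>\<rho>. finite (Q \<rho>)" and L: "\<And>\<rho>. \<rho> \<in> set_pmf P \<Longrightarrow> real (card (Q \<rho>)) \<le> L"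
  shows "(\<Sum>y\<in>hsphere d x (2*k-1). measure_pmf.prob P {\<rho>. \<exists>z\<in>Q \<rho> \<inter> cube d. hdist z y < k})
           \<le> L * (2 ^ (3*k) * real ((d - k) choose (k - 1)))"
proof -
  let ?M = "2 ^ (3*k) * ((d - k) choose (k - 1))"
  let ?Y = "hsphere d x (2*k-1)"
  let ?E = "\<lambda>y. {\<rho>. \<exists>z\<in>Q \<rho> \<inter> cube d. hdist z y < k}"
  have count: "(\<Sum>y\<in>?Y. indicat_real (?E y) \<rho>) \<le> L * real ?M" if "\<rho> \<in> set_pmf P" for \<rho>
  proof -
    have "(\<Sum>y\<in>?Y. indicat_real (?E y) \<rho>) = real (card {y \<in> ?Y. \<rho> \<in> ?E y})"
      by (simp add: indicator_def sum.If_cases Int_def)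
    also have "{y \<in> ?Y. \<rho> \<in> ?E y} = (\<Union>z\<in>Q \<rho> \<inter> cube d. {y \<in> ?Y. hdist z y < k})"
      by auto
    also have "card \<dots> \<le> (\<Sum>z\<in>Q \<rho> \<inter> cube d. card {y \<in> ?Y. hdist z y < k})"
      using Q by (intro card_UN_le) auto
    also have "\<dots> \<le> (\<Sum>z\<in>Q \<rho> \<inter> cube d. ?M)"
      using card_hsphere_near_point[OF x _ k] by (intro sum_mono) auto
    also have "\<dots> \<le> card (Q \<rho>) * ?M"
      using Q by (auto intro!: mult_right_mono card_mono)
    also have "real \<dots> \<le> L * real ?M"
      unfolding of_nat_mult[of "card (Q \<rho>)"] using L[OF that] by (intro mult_right_mono) auto
    finally show ?thesis by simp
  qed
  have "(\<Sum>y\<in>?Y. measure_pmf.prob P (?E y))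
          = (\<Sum>y\<in>?Y. measure_pmf.expectation P (indicat_real (?E y)))"
    by simp
  also have "\<dots> = measure_pmf.expectation P (\<lambda>\<rho>. \<Sum>y\<in>?Y. indicat_real (?E y) \<rho>)"
    by (subst Bochner_Integration.integral_sum) (auto intro!: measure_pmf.integrable_const_bound[where B = 1])
  also have "\<dots> \<le> L * real ?M"
    using count by (intro measure_pmf.integral_le_const Bochner_Integration.integrable_sum)
      (auto simp: AE_measure_pmf_iff intro!: measure_pmf.integrable_const_bound[where B = 1])
  finally show ?thesis by simp
qed

lemma prob_Int3_ge:
  fixes P :: "'a pmf"
  assumes "measure_pmf.prob P A \<ge> 3/4" "measure_pmf.prob P B \<ge> 3/4" "measure_pmf.prob P C \<ge> 3/4"
  shows "measure_pmf.prob P (A \<inter> B \<inter> C) \<ge> 1/4"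
proof -
  have compl: "measure_pmf.prob P (- X) = 1 - measure_pmf.prob P X" for X
    using measure_pmf.prob_compl[of X P] by (simp add: Compl_eq_Diff_UNIV)
  have "- (A \<inter> B \<inter> C) = - A \<union> - B \<union> - C" by auto
  then have "1 - measure_pmf.prob P (A \<inter> B \<inter> C) \<le> measure_pmf.prob P (- A \<union> - B) + measure_pmf.prob P (- C)"
    using measure_Un_le[of "- A \<union> - B" "measure_pmf P" "- C"]
    by (simp flip: compl)
  also have "\<dots> \<le> measure_pmf.prob P (- A) + measure_pmf.prob P (- B) + measure_pmf.prob P (- C)"
    using measure_Un_le[of "- A" "measure_pmf P" "- B"] by simp
  finally show ?thesis using assms by (simp add: compl)
qed

text \<open>A union bound leaves probability \<open>1/4\<close> that one seed is good for the
  valley, the hill and the combination at once. For the combination only the Lipschitz property of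
  the output is used.\<close>

lemma prob_queried_near_ge:
  assumes filt: "lipschitz_filter d (2 * real k) A P" and k: "k \<ge> 1"
    and x: "x \<in> cube d" and y: "y \<in> cube d" and xy: "hdist x y = 2 * k - 1"
  shows "1/4 \<le> measure_pmf.prob P {\<rho>. \<exists>z\<in>queried (valley d k x) (A x \<rho>) \<inter> cube d. hdist z y < k}
             + measure_pmf.prob P {\<rho>. \<exists>z\<in>queried (hill d k y) (A y \<rho>) \<inter> cube d. hdist z x < k}"
    (is "_ \<le> measure_pmf.prob P ?E1 + measure_pmf.prob P ?E2")
proof -
  let ?G = "\<lambda>f. {\<rho>. lipschitz_cube d (\<lambda>x. run_out f (A x \<rho>)) \<and>
               (lipschitz_cube d f \<longrightarrow> (\<forall>x\<in>cube d. run_out f (A x \<rho>) = f x))}"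
  have G: "measure_pmf.prob P (?G f) \<ge> 3/4" if "range_fun d (2 * real k) f" for f
    using filt that by (simp add: lipschitz_filter_def)
  let ?v = "valley d k x" and ?h = "hill d k y" and ?w = "valley_hill d k x y"
  have "?G ?v \<inter> ?G ?h \<inter> ?G ?w \<subseteq> ?E1 \<union> ?E2"
  proof
    fix \<rho> assume \<rho>: "\<rho> \<in> ?G ?v \<inter> ?G ?h \<inter> ?G ?w"
    show "\<rho> \<in> ?E1 \<union> ?E2"
    proof (rule ccontr)
      assume no: "\<rho> \<notin> ?E1 \<union> ?E2"
      have "run_out ?v (A x \<rho>) = run_out ?w (A x \<rho>)"
        using no by (intro run_out_cong_queried valley_hill_eq_valley[symmetric]) auto
      moreover have "run_out ?v (A x \<rho>) = 0"
        using \<rho> lipschitz_cube_valley[OF x] x by (auto simp: valley_def)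
      moreover have "run_out ?h (A y \<rho>) = run_out ?w (A y \<rho>)"
        using no by (intro run_out_cong_queried valley_hill_eq_hill[OF x y, symmetric]) auto
      moreover have "run_out ?h (A y \<rho>) = 2 * real k"
        using \<rho> lipschitz_cube_hill[OF y] y by (auto simp: hill_def)
      moreover have "\<bar>run_out ?w (A x \<rho>) - run_out ?w (A y \<rho>)\<bar> \<le> real (hdist x y)"
        using \<rho> x y by (auto simp: lipschitz_cube_def)
      \<comment> \<open>The outputs 0 and \<open>2 * k\<close> differ by one more than the distance
        \<open>2 * k - 1\<close>.\<close>
      ultimately show False using k xy by simp
    qed
  qed
  then have "measure_pmf.prob P (?G ?v \<inter> ?G ?h \<inter> ?G ?w) \<le> measure_pmf.prob P (?E1 \<union> ?E2)"
    by (intro measure_pmf.finite_measure_mono) auto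
  also have "\<dots> \<le> measure_pmf.prob P ?E1 + measure_pmf.prob P ?E2"
    by (intro measure_Un_le) auto
  finally show ?thesis
    using prob_Int3_ge[OF G[OF range_fun_valley] G[OF range_fun_hill] G[OF range_fun_valley_hill]]
    by (meson order_trans)
qed

text \<open>Double counting of ordered pairs at distance \<open>2 * k - 1\<close>: each contributes
  at least \<open>1/4\<close>, while each of the two families of events contributes at most
  \<open>?B\<close> per centre. Thus \<open>8 = 2 * 4\<close>.\<close>

lemma lipschitz_filter_lookups_bound:
  assumes filt: "lipschitz_filter d (2 * real k) A P" and k: "k \<ge> 1"
    and L: "\<And>f x \<rho>. range_fun d (2 * real k) f \<Longrightarrow> x \<in> cube d \<Longrightarrow> \<rho> \<in> set_pmf P \<Longrightarrow>
              real (lookups f (A x \<rho>)) \<le> L"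
  shows "real (d choose (2*k-1)) \<le> 8 * L * (2 ^ (3*k) * real ((d - k) choose (k - 1)))"
proof -
  let ?B = "L * (2 ^ (3*k) * real ((d - k) choose (k - 1)))"
  let ?S = "\<lambda>x. hsphere d x (2*k-1)"
  let ?p = "\<lambda>x y. measure_pmf.prob P {\<rho>. \<exists>z\<in>queried (valley d k x) (A x \<rho>) \<inter> cube d. hdist z y < k}"
  let ?q = "\<lambda>x y. measure_pmf.prob P {\<rho>. \<exists>z\<in>queried (hill d k y) (A y \<rho>) \<inter> cube d. hdist z x < k}"
  have p: "(\<Sum>y\<in>?S x. ?p x y) \<le> ?B" if "x \<in> cube d" for x
    using that L[OF range_fun_valley that]
    by (intro sum_prob_queried_near_le k) (auto intro: order_trans[OF of_nat_mono[OF card_queried_le]])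
  have q: "(\<Sum>x\<in>?S y. ?q x y) \<le> ?B" if "y \<in> cube d" for y
    using that L[OF range_fun_hill that]
    by (intro sum_prob_queried_near_le k) (auto intro: order_trans[OF of_nat_mono[OF card_queried_le]])
  have "2 ^ d * (real (d choose (2*k-1)) * (1/4)) = (\<Sum>x\<in>cube d. \<Sum>y\<in>?S x. 1/4)"
    by (simp add: card_hsphere card_cube)
  also have "\<dots> \<le> (\<Sum>x\<in>cube d. \<Sum>y\<in>?S x. ?p x y + ?q x y)"
    using prob_queried_near_ge[OF filt k] by (intro sum_mono) (auto simp: hsphere_def)
  also have "\<dots> = (\<Sum>x\<in>cube d. \<Sum>y\<in>?S x. ?p x y) + (\<Sum>x\<in>cube d. \<Sum>y\<in>?S x. ?q x y)"
    by (simp add: sum.distrib)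
  \<comment> \<open>The hill run depends on \<open>y\<close> alone, so \<open>y\<close> must be the
    fixed centre when the averaging bound is applied.\<close>
  also have "(\<Sum>x\<in>cube d. \<Sum>y\<in>?S x. ?q x y) = (\<Sum>y\<in>cube d. \<Sum>x\<in>?S y. ?q x y)"
    unfolding hsphere_def
    by (subst sum.swap_restrict) (auto intro!: sum.cong simp: hdist_commute)
  also have "(\<Sum>x\<in>cube d. \<Sum>y\<in>?S x. ?p x y) + \<dots> \<le> (\<Sum>x\<in>cube d. ?B) + (\<Sum>y\<in>cube d. ?B)"
    using p q by (intro add_mono sum_mono) auto
  also have "\<dots> = 2 ^ d * (2 * ?B)"
    by (simp add: card_cube)
  finally have "real (d choose (2*k-1)) * (1/4) \<le> 2 * ?B"
    by (subst (asm) mult_le_cancel_left_pos) auto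
  then show ?thesis by simp
qed

text \<open>Rewriting \<open>d choose (2*k-1)\<close> through \<open>d choose k\<close> cancels the
  factor \<open>(d - k) choose (k - 1)\<close>. With \<open>s\<close> the square root of
  \<open>d / (2*k)\<close>, what remains is \<open>4 * 16 ^ k < s ^ k\<close>.\<close>

lemma binomial_lower_bound:
  fixes k d :: nat
  assumes k: "k \<ge> 2" and d: "d \<ge> 2 ^ 16 * (2 * k)"
  shows "8 * (real d / real (2*k)) powr (real k / 2) * (2 ^ (3*k) * real ((d - k) choose (k - 1)))
           < real (d choose (2*k-1))"
proof -
  define D where "D = real d / real (2*k)"
  define C where "C = real ((d - k) choose (k - 1))"
  define s where "s = sqrt D"
  have "real (2 ^ 16 * (2 * k)) \<le> real d"
    using d by (intro of_nat_mono)
  then have D: "D \<ge> 2 ^ 16"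
    using k by (simp add: D_def field_simps)
  \<comment> \<open>Here the constant \<open>2 ^ 16\<close> enters: \<open>2 ^ 8 = 16 * 16\<close>,
    so one factor \<open>16 ^ k\<close> matches the exponential loss and the other exceeds
    4.\<close>
  then have s: "s \<ge> 2 ^ 8" unfolding s_def by (intro real_le_rsqrt) simp
  have ss: "s ^ 2 = D" using D by (simp add: s_def)
  have "D powr (real k / 2) = (D powr (1/2)) powr real k"
    by (simp add: powr_powr)
  then have powr: "D powr (real k / 2) = s ^ k"
    using s D by (simp add: powr_half_sqrt s_def powr_realpow)
  have C: "C > 0"
    using k d by (simp add: C_def)
  have "(4::real) < 16 ^ 1" by simp
  also have "\<dots> \<le> 16 ^ k" using k by (intro power_increasing) auto
  finally have "4 * 16 ^ k < (16::real) ^ k * 16 ^ k" by simp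
  also have "\<dots> = (2 ^ 8) ^ k" by (simp flip: power_mult_distrib)
  also have "\<dots> \<le> s ^ k" using s by (intro power_mono) auto
  finally have "4 * 16 ^ k * s ^ k < s ^ k * s ^ k"
    using s by (intro mult_strict_right_mono) auto
  also have "\<dots> = D ^ k" by (simp add: power2_eq_square power_mult_distrib flip: ss)
  finally have "2 ^ k * (4 * 16 ^ k * s ^ k) < 2 ^ k * D ^ k" by simp
  also have "2 ^ k * D ^ k = (real d / real k) ^ k"
    by (simp add: D_def flip: power_mult_distrib)
  also have "\<dots> \<le> real (d choose k)"
    using k d by (intro binomial_ge_n_over_k_pow_k) simp
  finally have "2 ^ k * (4 * 16 ^ k * s ^ k) * C < real (d choose k) * C"
    using C by simp
  \<comment> \<open>Both sides count a \<open>(2*k-1)\<close>-subset with a marked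
    \<open>k\<close>-subset.\<close>
  also have "\<dots> = real ((d choose (2*k-1)) * ((2*k-1) choose k))"
  proof -
    have "(d choose (2*k-1)) * ((2*k-1) choose k) = (d choose k) * ((d - k) choose (2*k-1-k))"
      using k d by (intro choose_mult) auto
    moreover have "2*k-1-k = k-1" by simp
    ultimately show ?thesis by (simp add: C_def)
  qed
  also have "\<dots> \<le> real (d choose (2*k-1)) * 2 ^ (2*k-1)"
    unfolding of_nat_mult using of_nat_mono[OF binomial_le_pow2[of "2*k-1" k], where 'a = real]
    by (intro mult_left_mono) (simp_all only: of_nat_power of_nat_numeral of_nat_0_le_iff)
  finally have "2 * (2 ^ k * (4 * 16 ^ k * s ^ k) * C) < real (d choose (2*k-1)) * (2 * 2 ^ (2*k-1))"
    by (simp add: mult_ac)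
  also have "2 * (2::real) ^ (2*k-1) = 2 ^ (2*k)"
    using k by (subst power_Suc[symmetric]) simp
  also have "2 * (2 ^ k * (4 * 16 ^ k * s ^ k) * C) = 8 * s ^ k * (2 ^ (3*k) * C) * 2 ^ (2*k)"
  proof -
    have "(2::real) ^ k * 16 ^ k = 2 ^ (3*k) * 2 ^ (2*k)"
      by (simp add: power_mult flip: power_mult_distrib)
    then show ?thesis by simp
  qed
  finally have "8 * s ^ k * (2 ^ (3*k) * C) < real (d choose (2*k-1))"
    by simp
  then show ?thesis
    unfolding powr[symmetric] unfolding D_def C_def .
qed

theorem theorem4p1:
  shows "\<exists>c::real. c > 0 \<and>
    (\<forall>(r::nat) (d::nat) (A :: bool list \<Rightarrow> nat \<Rightarrow> real ocomp) (P :: nat pmf).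
       even r \<and> r \<ge> 4 \<and> d \<ge> 2^16 * r \<and> lipschitz_filter d (real r) A P \<longrightarrow>
       (\<exists>f. range_fun d (real r) f \<and>
          (\<exists>x\<in>cube d. \<exists>\<rho>\<in>set_pmf P.
             real (lookups f (A x \<rho>)) \<ge> (real d / real r) powr (c * real r))))"
\<comment> \<open>With \<open>r = 2 * k\<close>, the exponent \<open>r / 4\<close> is the
  \<open>k / 2\<close> of the binomial estimate.\<close>
proof (intro exI[of _ "1/4"] conjI allI impI)
  fix r d :: nat and A :: "bool list \<Rightarrow> nat \<Rightarrow> real ocomp" and P :: "nat pmf"
  assume asm: "even r \<and> r \<ge> 4 \<and> d \<ge> 2^16 * r \<and> lipschitz_filter d (real r) A P"
  then obtain k where r: "r = 2 * k" by blast
  let ?L = "(real d / real r) powr (1/4 * real r)"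
  show "\<exists>f. range_fun d (real r) f \<and>
          (\<exists>x\<in>cube d. \<exists>\<rho>\<in>set_pmf P. real (lookups f (A x \<rho>)) \<ge> ?L)"
  proof (rule ccontr)
    assume "\<not> ?thesis"
    \<comment> \<open>Weakening to a non-strict bound is harmless: the final contradiction rests on
      the strict binomial inequality.\<close>
    then have "real (lookups f (A x \<rho>)) \<le> ?L"
      if "range_fun d (2 * real k) f" "x \<in> cube d" "\<rho> \<in> set_pmf P" for f x \<rho>
      using that r by (force simp: not_le)
    then have "real (d choose (2*k-1)) \<le> 8 * ?L * (2 ^ (3*k) * real ((d - k) choose (k - 1)))"
      using asm r by (intro lipschitz_filter_lookups_bound[of d k A P]) auto
    moreover have "?L = (real d / real (2*k)) powr (real k / 2)"
      by (simp add: r)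
    ultimately show False
      using binomial_lower_bound[of k d] asm r by simp
  qed
qed simp

end
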